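(* Let $G$ be one of the extensions of an elementary abelian group $A$ of order $8$ or $64$ described in the context. Then the number of conjugacy classes of $G$ is $NFC+FC$.
   Context: The groups $G$ considered are finite irreducible subgroups of $SO(7)$ (real orthogonal $7\times 7$ matrices of determinant $1$) which are imprimitive (permuting a set of more than one linearly independent non-trivial subspaces whose direct sum is $\mathbb{R}^7$) but not quasi-primitive (there is a normal subgroup to which the restriction of the representation has non-isomorphic irreducible constituents), and which are of one of the following types, with $A$ a normal elementary abelian subgroup of $G$: (i) $|A|=8$ and $G/A$ is a subgroup of $PSL(3,2)$, being either of order $7$ or $21$ inside the normalizer of a Sylow $7$-subgroup, or the full $PSL(3,2)$; (ii) $|A|=64$ and $G/A$ is a subgroup of $\mathrm{Sym}(7)$, being either of order $7$, $14$, $21$ or $42$ inside the normalizer of a Sylow $7$-subgroup, or one of $PSL(3,2)$, $\mathrm{Alt}(7)$, $\mathrm{Sym}(7)$. The extension of $A$ by $G/A$ is split when $|G/A|$ is odd; it is not assumed to be split when $|G/A|$ is even. $NFC$ is the number of irreducible complex characters of $G/A$ (equivalently, irreducible characters of $G$ having $A$ in the kernel). $FC$ is the number of irreducible complex characters of $G$ which do not have $A$ in the kernel. *)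

theory Defs
  imports
    "HOL-Analysis.Analysis"
    "HOL-Library.Z2"
    "HOL-Algebra.Group_Action"
    "HOL-Algebra.Sym_Groups"
    "Jordan_Normal_Form.VS_Connect"
begin

text \<open>Matrices of fixed size have type \<open>_^'n^'n\<close>; complex representations, whose degree
  is quantified over, take values in \<open>complex mat\<close>, whose dimensions are not part of the type.\<close>

section \<open>Matrix groups\<close>

definition SO :: "(real^'n^'n) monoid" where
  "SO = \<lparr>carrier = {M. orthogonal_matrix M \<and> Determinants.det M = 1},
         monoid.mult = (**), one = Finite_Cartesian_Product.mat 1\<rparr>"

definition SL :: "('k::field^'n^'n) monoid" where
  "SL = \<lparr>carrier = {M. Determinants.det M = 1},
         monoid.mult = (**), one = Finite_Cartesian_Product.mat 1\<rparr>"

definition PSL :: "('k::field^'n^'n) set monoid" where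
  "PSL = SL Mod {M \<in> carrier SL. \<exists>c. M = Finite_Cartesian_Product.mat c}"

text \<open>The type \<open>bit\<close> is the field with two elements.\<close>

abbreviation PSL_3_2 :: "(bit^3^3) set monoid" where
  "PSL_3_2 \<equiv> PSL"

section \<open>Real linear groups\<close>

definition invariant_subspace :: "(real^'n^'n) set \<Rightarrow> (real^'n) set \<Rightarrow> bool" where
  "invariant_subspace G V \<longleftrightarrow>
     Real_Vector_Spaces.subspace V \<and> (\<forall>M\<in>G. \<forall>v\<in>V. M *v v \<in> V)"

definition irreducible_subspace :: "(real^'n^'n) set \<Rightarrow> (real^'n) set \<Rightarrow> bool" where
  "irreducible_subspace G V \<longleftrightarrow>
     invariant_subspace G V \<and> V \<noteq> {0} \<and>
     (\<forall>W. invariant_subspace G W \<and> W \<subseteq> V \<longrightarrow> W = {0} \<or> W = V)"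

definition irreducible_linear_group :: "(real^'n^'n) set \<Rightarrow> bool" where
  "irreducible_linear_group G \<longleftrightarrow> irreducible_subspace G UNIV"

definition isomorphic_subspaces ::
    "(real^'n^'n) set \<Rightarrow> (real^'n) set \<Rightarrow> (real^'n) set \<Rightarrow> bool" where
  "isomorphic_subspaces G V W \<longleftrightarrow>
     (\<exists>f. Real_Vector_Spaces.linear f \<and> bij_betw f V W \<and>
          (\<forall>M\<in>G. \<forall>v\<in>V. f (M *v v) = M *v f v))"

definition direct_sum_decomposition :: "(real^'n) set set \<Rightarrow> bool" where
  "direct_sum_decomposition S \<longleftrightarrow>
     finite S \<and> (\<forall>V\<in>S. Real_Vector_Spaces.subspace V) \<and>
     (\<forall>f. (\<forall>V\<in>S. f V \<in> V) \<and> (\<Sum>V\<in>S. f V) = 0 \<longrightarrow> (\<forall>V\<in>S. f V = 0)) \<and>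
     Real_Vector_Spaces.span (\<Union>S) = UNIV"

definition imprimitive_linear_group :: "(real^'n^'n) set \<Rightarrow> bool" where
  "imprimitive_linear_group G \<longleftrightarrow>
     (\<exists>S. direct_sum_decomposition S \<and> card S > 1 \<and> {0} \<notin> S \<and>
          (\<forall>M\<in>G. bij_betw (\<lambda>V. (*v) M ` V) S S))"

text \<open>For a finite group, complete reducibility makes the irreducible constituents of a
  restriction the same as its irreducible invariant subspaces.\<close>

definition quasi_primitive_linear_group :: "(real^'n^'n) set \<Rightarrow> bool" where
  "quasi_primitive_linear_group G \<longleftrightarrow>
     (\<forall>N. N \<lhd> SO\<lparr>carrier := G\<rparr> \<longrightarrow>
        (\<forall>V W. irreducible_subspace N V \<and> irreducible_subspace N W \<longrightarrow>
               isomorphic_subspaces N V W))"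

section \<open>Abstract groups\<close>

definition elementary_abelian_group :: "('a, 'b) monoid_scheme \<Rightarrow> bool" where
  "elementary_abelian_group G \<longleftrightarrow>
     comm_group G \<and>
     (\<exists>p::nat. prime p \<and> (\<forall>x\<in>carrier G. x [^]\<^bsub>G\<^esub> p = \<one>\<^bsub>G\<^esub>))"

definition sylow_subgroup :: "nat \<Rightarrow> 'a set \<Rightarrow> ('a, 'b) monoid_scheme \<Rightarrow> bool" where
  "sylow_subgroup p P G \<longleftrightarrow>
     subgroup P G \<and> card P = p ^ multiplicity p (Coset.order G)"

definition in_sylow_normalizer :: "nat \<Rightarrow> 'a set \<Rightarrow> ('a, 'b) monoid_scheme \<Rightarrow> bool" where
  "in_sylow_normalizer p H G \<longleftrightarrow>
     (\<exists>P. sylow_subgroup p P G \<and> H \<subseteq> normalizer G P)"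

definition split_extension :: "('a, 'b) monoid_scheme \<Rightarrow> 'a set \<Rightarrow> bool" where
  "split_extension G A \<longleftrightarrow>
     (\<exists>H. subgroup H G \<and> A \<inter> H = {\<one>\<^bsub>G\<^esub>} \<and> A <#>\<^bsub>G\<^esub> H = carrier G)"

definition conjugacy_classes :: "('a, 'b) monoid_scheme \<Rightarrow> 'a set set" where
  "conjugacy_classes G =
     orbits G (carrier G) (\<lambda>g. \<lambda>h\<in>carrier G. g \<otimes>\<^bsub>G\<^esub> h \<otimes>\<^bsub>G\<^esub> inv\<^bsub>G\<^esub> g)"

section \<open>The two types of extension\<close>

definition extension_type_8 :: "('a, 'b) monoid_scheme \<Rightarrow> 'a set \<Rightarrow> bool" where
  "extension_type_8 G A \<longleftrightarrow>
     card A = 8 \<and>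
     (\<exists>H. subgroup H PSL_3_2 \<and> G Mod A \<cong> PSL_3_2\<lparr>carrier := H\<rparr> \<and>
        (card H \<in> {7, 21} \<and> in_sylow_normalizer 7 H PSL_3_2 \<or>
         H = carrier PSL_3_2))"

definition extension_type_64 :: "('a, 'b) monoid_scheme \<Rightarrow> 'a set \<Rightarrow> bool" where
  "extension_type_64 G A \<longleftrightarrow>
     card A = 64 \<and>
     (\<exists>H. subgroup H (sym_group 7) \<and> G Mod A \<cong> (sym_group 7)\<lparr>carrier := H\<rparr> \<and>
        (card H \<in> {7, 14, 21, 42} \<and> in_sylow_normalizer 7 H (sym_group 7) \<or>
         (sym_group 7)\<lparr>carrier := H\<rparr> \<cong> PSL_3_2 \<or>
         H = carrier (alt_group 7) \<or>
         H = carrier (sym_group 7)))"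

section \<open>Complex characters\<close>

definition complex_representation ::
    "('a, 'b) monoid_scheme \<Rightarrow> nat \<Rightarrow> ('a \<Rightarrow> complex Matrix.mat) \<Rightarrow> bool" where
  "complex_representation G n \<rho> \<longleftrightarrow>
     \<rho> \<in> hom G (units_of (ring_mat TYPE(complex) n ()))"

definition irreducible_representation ::
    "('a, 'b) monoid_scheme \<Rightarrow> nat \<Rightarrow> ('a \<Rightarrow> complex Matrix.mat) \<Rightarrow> bool" where
  "irreducible_representation G n \<rho> \<longleftrightarrow>
     complex_representation G n \<rho> \<and> n > 0 \<and>
     (\<forall>W. VectorSpace.subspace class_ring W (module_vec TYPE(complex) n) \<and>
          (\<forall>g\<in>carrier G. \<forall>w\<in>W. \<rho> g *\<^sub>v w \<in> W) \<longrightarrow>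
          W = {0\<^sub>v n} \<or> W = carrier_vec n)"

definition mat_trace :: "complex Matrix.mat \<Rightarrow> complex" where
  "mat_trace M = (\<Sum>i<dim_row M. M $$ (i, i))"

text \<open>Characters are restricted to the carrier, so that two of them are equal as functions
  iff they agree on the group; otherwise counting them would be meaningless.\<close>

definition character ::
    "('a, 'b) monoid_scheme \<Rightarrow> ('a \<Rightarrow> complex Matrix.mat) \<Rightarrow> 'a \<Rightarrow> complex" where
  "character G \<rho> = (\<lambda>g\<in>carrier G. mat_trace (\<rho> g))"

definition irreducible_characters ::
    "('a, 'b) monoid_scheme \<Rightarrow> ('a \<Rightarrow> complex) set" where
  "irreducible_characters G =
     {character G \<rho> | n \<rho>. irreducible_representation G n \<rho>}"

definition character_kernel ::
    "('a, 'b) monoid_scheme \<Rightarrow> ('a \<Rightarrow> complex) \<Rightarrow> 'a set" where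
  "character_kernel G \<psi> = {g \<in> carrier G. \<psi> g = \<psi> \<one>\<^bsub>G\<^esub>}"

definition NFC :: "('a, 'b) monoid_scheme \<Rightarrow> 'a set \<Rightarrow> nat" where
  "NFC G A = card (irreducible_characters (G Mod A))"

definition FC :: "('a, 'b) monoid_scheme \<Rightarrow> 'a set \<Rightarrow> nat" where
  "FC G A = card {\<psi> \<in> irreducible_characters G. \<not> A \<subseteq> character_kernel G \<psi>}"

end

theory Submission
  imports Defs "Jordan_Normal_Form.DL_Rank" "Jordan_Normal_Form.Spectral_Radius"
begin

text \<open>The equation is an instance of two facts about a finite group \<open>G\<close> with a normal subgroup \<open>A\<close>: the
  number of conjugacy classes of \<open>G\<close> is the number of its irreducible characters, and these fall
  into two kinds. Those whose kernel does not contain \<open>A\<close> are counted by \<open>FC\<close>; the others are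
  exactly the inflations of the irreducible characters of the factor group, so \<open>NFC\<close> counts them.

  For the number of irreducible characters, Schur's lemma (\<open>Schur_invertible\<close>, \<open>Schur_scalar\<close>) gives
  the orthogonality of irreducible characters. Every character is a combination of irreducible
  ones, by splitting the trace along invariant subspaces
  (\<open>trace_splits_along_invariant_subspace\<close>). Applied to the regular representation this yields
  \<open>regular_character_decomposition\<close>: there are finitely many irreducible characters, and the sum of
  the \<open>\<phi> \<one> * \<phi> g\<close> is the regular character. Together with the fact that a class sum acts on an
  irreducible representation as a scalar (\<open>irreducible_character_class_sum\<close>), it follows that the sum
  of \<open>\<phi> g * \<phi> (inv g)\<close> over the irreducible characters is the order of the centralizer of \<open>g\<close>
  (\<open>column_orthogonality\<close>). Summing this over \<open>g\<close> and comparing with Burnside's lemma counts the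
  classes.

  For the inflation part, an irreducible representation \<open>\<rho>\<close> whose character is constant on
  \<open>A\<close> is trivial on \<open>A\<close>: the sum of the \<open>\<rho> a\<close> over \<open>A\<close> is a scalar by Schur's lemma, and its trace
  shows that the scalar is the order of \<open>A\<close> (\<open>trivial_on_character_kernel\<close>).\<close>

section \<open>Subspaces of coordinate space\<close>

text \<open>In what follows \<open>$\<close> is the index of vectors whose dimension is not part of the type.\<close>

no_notation Finite_Cartesian_Product.vec_nth (infixl "$" 90)

lemma subspace_vec_iff:
  "VectorSpace.subspace class_ring W (module_vec TYPE('a::field) n) \<longleftrightarrow>
     W \<subseteq> carrier_vec n \<and> 0\<^sub>v n \<in> W \<and> (\<forall>v\<in>W. \<forall>w\<in>W. v + w \<in> W) \<and> (\<forall>c. \<forall>v\<in>W. c \<cdot>\<^sub>v v \<in> W)"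
  unfolding VectorSpace.subspace_def LinearCombinations.submodule_def
  using vec_vs[of n, where 'a='a] vec_module[of n, where 'a='a]
  by (auto simp: module_vec_simps)

text \<open>A basis of \<open>W\<close> is extended to a basis of the whole space and its vectors are written into the
  columns of \<open>P\<close>, those of \<open>W\<close> first. In the coordinates given by \<open>Q\<close>, the inverse of \<open>P\<close>, the
  subspace is then the span of the first \<open>k\<close> unit vectors, so that a matrix leaving \<open>W\<close> invariant
  becomes block upper triangular.\<close>

lemma subspace_adapted_basis:
  fixes W :: "'a::field Matrix.vec set"
  assumes W: "VectorSpace.subspace class_ring W (module_vec TYPE('a) n)"
  obtains P Q k where
    "P \<in> carrier_mat n n" "Q \<in> carrier_mat n n" "P * Q = 1\<^sub>m n" "Q * P = 1\<^sub>m n" "k \<le> n"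
    "\<forall>j<k. col P j \<in> W"
    "\<forall>w\<in>W. \<forall>i. k \<le> i \<longrightarrow> i < n \<longrightarrow> (Q *\<^sub>v w) $ i = 0"
    "k = n \<longrightarrow> W = carrier_vec n"
proof -
  interpret vec_space "TYPE('a)" n .
  have Wc: "W \<subseteq> carrier_vec n" and Wsub: "LinearCombinations.submodule class_ring W V"
    using W unfolding VectorSpace.subspace_def LinearCombinations.submodule_def
    by (auto simp: module_vec_simps)
  have bound: "finite S \<and> card S \<le> n" if "S \<subseteq> carrier_vec n" "lin_indpt S" for S
    using li_le_dim[OF fin_dim that] dim_is_n by simp
  have empty: "lin_indpt {}" unfolding lin_dep_def by simp
  obtain U where finU: "finite U" and Umaximal: "maximal U (\<lambda>S. S \<subseteq> W \<and> lin_indpt S)"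
    using maximal_exists[of "\<lambda>S. S \<subseteq> W \<and> lin_indpt S" n "{}"] bound Wc empty
    by (metis (no_types, lifting) empty_subsetI order_trans)
  have U: "U \<subseteq> W" "lin_indpt U" using Umaximal unfolding maximal_def by simp_all
  have Umax: "S = U" if "U \<subseteq> S" "S \<subseteq> W" "lin_indpt S" for S
    using Umaximal that unfolding maximal_def by simp
  have Uc: "U \<subseteq> carrier_vec n" using U(1) Wc by (rule order_trans)
  obtain T where finT: "finite T"
    and Tmaximal: "maximal T (\<lambda>S. U \<subseteq> S \<and> S \<subseteq> carrier_vec n \<and> lin_indpt S)"
    using maximal_exists[of "\<lambda>S. U \<subseteq> S \<and> S \<subseteq> carrier_vec n \<and> lin_indpt S" n U] bound U(2) Uc
    by (metis (no_types, lifting) order_refl)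
  have T: "U \<subseteq> T" "T \<subseteq> carrier_vec n" "lin_indpt T"
    using Tmaximal unfolding maximal_def by simp_all
  have "maximal T (\<lambda>S. S \<subseteq> carrier_vec n \<and> lin_indpt S)"
    using Tmaximal T unfolding maximal_def by (metis order_trans)
  then have basisT: "basis T" by (rule max_li_is_basis)
  have cardT: "card T = n" using dim_basis[OF finT basisT] dim_is_n by simp
  have spanU: "W \<subseteq> span U"
  proof
    fix w assume w: "w \<in> W"
    show "w \<in> span U"
    proof (cases "w \<in> U")
      case True
      then show ?thesis using in_own_span[OF Uc] by blast
    next
      case False
      then have "lin_dep (insert w U)" using Umax[of "insert w U"] w U by auto
      then show ?thesis
        using lin_dep_iff_in_span[OF Uc U(2) _ False] w Wc by auto
    qed
  qed
  obtain us where us: "set us = U" "distinct us" using finite_distinct_list[OF finU] by blast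
  obtain ts where ts: "set ts = T - U" "distinct ts" using finite_distinct_list[of "T - U"] finT by blast
  define k where "k = length us"
  define P where "P = mat_of_cols n (us @ ts)"
  have set_cols: "set (us @ ts) = T" using us ts T by auto
  have dist: "distinct (us @ ts)" using us ts by auto
  have len: "length (us @ ts) = n" using distinct_card[OF dist] set_cols cardT by simp
  have P: "P \<in> carrier_mat n n" using len unfolding P_def by (metis mat_of_cols_carrier(1))
  have colsP: "cols P = us @ ts"
    unfolding P_def by (rule cols_mat_of_cols) (use set_cols T in auto)
  have "Determinant.det P \<noteq> 0"
    using det_0_iff_vec_prod_zero_field[OF P] lin_depI[OF P] colsP dist set_cols T by metis
  then obtain Q where Q: "Q \<in> carrier_mat n n" "P * Q = 1\<^sub>m n" "Q * P = 1\<^sub>m n"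
    using det_non_zero_imp_unit[OF P] unfolding Units_def ring_mat_def by auto
  have colU: "col P j \<in> U" if "j < k" for j
    using that colsP cols_nth[of j P] P len us nth_mem[of j us]
    by (auto simp: k_def nth_append)
  have kn: "k \<le> n" using len by (simp add: k_def)
  \<comment> \<open>The vectors whose last coordinates vanish form a subspace, so it is enough to test the basis of \<open>W\<close>.\<close>
  let ?S = "{w \<in> carrier_vec n. \<forall>i. k \<le> i \<longrightarrow> i < n \<longrightarrow> (Q *\<^sub>v w) $ i = 0}"
  have "VectorSpace.subspace class_ring ?S V"
    unfolding subspace_vec_iff using Q(1)
    by (auto simp: scalar_prod_add_distrib[of _ n])
  then have Ssub: "LinearCombinations.submodule class_ring ?S V"
    unfolding VectorSpace.subspace_def by auto
  have "U \<subseteq> ?S"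
  proof
    fix u assume u: "u \<in> U"
    then obtain j where j: "j < k" "u = us ! j" using us by (metis in_set_conv_nth k_def)
    then have "u = col P j" using colsP cols_nth[of j P] P kn by (simp add: k_def nth_append)
    then have "Q *\<^sub>v u = col (Q * P) j" using col_mult2[OF Q(1) P, of j] j kn by simp
    then have "Q *\<^sub>v u = unit_vec n j" using Q j kn by simp
    then show "u \<in> ?S" using j kn u T by auto
  qed
  then have "span U \<subseteq> ?S" by (rule span_is_subset[OF _ Ssub])
  then have van: "(Q *\<^sub>v w) $ i = 0" if "w \<in> W" "k \<le> i" "i < n" for w i
    using spanU that by auto
  have full: "W = carrier_vec n" if "k = n"
  proof -
    have "card U = n" using that us distinct_card k_def by fastforce
    then have "U = T" using card_subset_eq[OF finT T(1)] cardT by simp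
    then have "span U = carrier_vec n" using basisT unfolding basis_def by simp
    moreover have "span U \<subseteq> W" by (rule span_is_subset[OF U(1) Wsub])
    ultimately show ?thesis using Wc by auto
  qed
  show thesis
    by (rule that[OF P Q kn]) (use colU U van full in auto)
qed

section \<open>Representations and traces\<close>

lemma mat_mult_entry:
  assumes "A \<in> carrier_mat n m" "B \<in> carrier_mat m p" "i < n" "j < p"
  shows "(A * B) $$ (i, j) = (\<Sum>k<m. A $$ (i, k) * B $$ (k, j))"
  using assms by (auto simp: scalar_prod_def lessThan_atLeast0)

lemma mat_trace_eq_sum: "A \<in> carrier_mat n n \<Longrightarrow> mat_trace A = (\<Sum>i<n. A $$ (i, i))"
  unfolding mat_trace_def by auto

lemma mat_trace_mult_commute:
  assumes A: "A \<in> carrier_mat n m" and B: "B \<in> carrier_mat m n"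
  shows "mat_trace (A * B) = mat_trace (B * A)"
proof -
  have "mat_trace (A * B) = (\<Sum>i<n. \<Sum>k<m. A $$ (i, k) * B $$ (k, i))"
    using mat_trace_eq_sum[OF mult_carrier_mat[OF A B]] mat_mult_entry[OF A B] by simp
  also have "\<dots> = (\<Sum>k<m. \<Sum>i<n. B $$ (k, i) * A $$ (i, k))"
    by (subst sum.swap) (simp add: mult.commute)
  also have "\<dots> = mat_trace (B * A)"
    using mat_trace_eq_sum[OF mult_carrier_mat[OF B A]] mat_mult_entry[OF B A] by simp
  finally show ?thesis .
qed

lemma mat_trace_one: "mat_trace (1\<^sub>m n) = of_nat n"
  by (simp add: mat_trace_def)

context group
begin

text \<open>The values are invertible matrices because \<open>\<rho> (inv g)\<close> inverts \<open>\<rho> g\<close>, so only matrix identities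
  remain to be checked.\<close>

lemma complex_representation_iff:
  "complex_representation G n \<rho> \<longleftrightarrow>
     (\<forall>g\<in>carrier G. \<rho> g \<in> carrier_mat n n) \<and>
     (\<forall>g\<in>carrier G. \<forall>h\<in>carrier G. \<rho> (g \<otimes> h) = \<rho> g * \<rho> h) \<and> \<rho> \<one> = 1\<^sub>m n"
  (is "?L \<longleftrightarrow> ?R")
proof
  let ?M = "ring_mat TYPE(complex) n ()"
  interpret M: ring ?M by (rule Matrix.ring_mat)
  have U: "group (units_of ?M)" by (rule M.units_group)
  assume ?L
  then have hom: "\<rho> \<in> hom G (units_of ?M)" unfolding complex_representation_def .
  interpret group_hom G "units_of ?M" \<rho>
    using U hom is_group by (simp add: group_hom_def group_hom_axioms_def)
  show ?R
    using hom hom_one by (auto simp: hom_def units_of_def Units_def ring_mat_def Pi_def)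
next
  assume R: ?R
  have "\<rho> g \<in> Units (ring_mat TYPE(complex) n ())" if g: "g \<in> carrier G" for g
  proof -
    have "\<rho> g * \<rho> (inv g) = 1\<^sub>m n" "\<rho> (inv g) * \<rho> g = 1\<^sub>m n"
      using R g by (metis inv_closed r_inv, metis inv_closed l_inv)
    then show ?thesis using R g by (auto simp: Units_def ring_mat_def)
  qed
  then show ?L using R
    unfolding complex_representation_def by (auto simp: hom_def units_of_def ring_mat_def)
qed

lemma
  assumes "complex_representation G n \<rho>"
  shows representation_carrier: "g \<in> carrier G \<Longrightarrow> \<rho> g \<in> carrier_mat n n"
    and representation_mult: "g \<in> carrier G \<Longrightarrow> h \<in> carrier G \<Longrightarrow> \<rho> (g \<otimes> h) = \<rho> g * \<rho> h"
    and representation_one: "\<rho> \<one> = 1\<^sub>m n"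
  using assms unfolding complex_representation_iff by auto

lemma representation_mult_entry:
  assumes \<rho>: "complex_representation G n \<rho>" and gh: "g \<in> carrier G" "h \<in> carrier G"
    and ij: "i < n" "j < n"
  shows "\<rho> (g \<otimes> h) $$ (i, j) = (\<Sum>k<n. \<rho> g $$ (i, k) * \<rho> h $$ (k, j))"
  using mat_mult_entry[OF representation_carrier[OF \<rho>] representation_carrier[OF \<rho>]]
    representation_mult[OF \<rho>] gh ij by simp

text \<open>After a change of basis adapted to \<open>W\<close> all the matrices are block upper triangular, the two
  diagonal blocks are again representations (on \<open>W\<close> and on the quotient by \<open>W\<close>), and the trace is
  the sum of the traces of the blocks; the off-diagonal block is invisible to characters.\<close>

lemma trace_splits_along_invariant_subspace:
  assumes \<rho>: "complex_representation G n \<rho>"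
    and W: "VectorSpace.subspace class_ring W (module_vec TYPE(complex) n)"
    and inv: "\<And>g w. g \<in> carrier G \<Longrightarrow> w \<in> W \<Longrightarrow> \<rho> g *\<^sub>v w \<in> W"
    and proper: "W \<noteq> {0\<^sub>v n}" "W \<noteq> carrier_vec n"
  obtains k \<sigma> \<tau> where "0 < k" "k < n"
    "complex_representation G k \<sigma>" "complex_representation G (n - k) \<tau>"
    "\<And>g. g \<in> carrier G \<Longrightarrow> mat_trace (\<rho> g) = mat_trace (\<sigma> g) + mat_trace (\<tau> g)"
proof -
  obtain P Q k where P: "P \<in> carrier_mat n n" and Q: "Q \<in> carrier_mat n n"
    and PQ: "P * Q = 1\<^sub>m n" and QP: "Q * P = 1\<^sub>m n" and kn: "k \<le> n"
    and colP: "\<forall>j<k. col P j \<in> W"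
    and van: "\<forall>w\<in>W. \<forall>i. k \<le> i \<longrightarrow> i < n \<longrightarrow> (Q *\<^sub>v w) $ i = 0"
    and full: "k = n \<longrightarrow> W = carrier_vec n"
    by (rule subspace_adapted_basis[OF W])
  have Wc: "W \<subseteq> carrier_vec n" and W0: "0\<^sub>v n \<in> W" using W unfolding subspace_vec_iff by auto
  have "k > 0"
  proof (rule ccontr)
    assume "\<not> k > 0"
    have "w = 0\<^sub>v n" if w: "w \<in> W" for w
    proof -
      have wc: "w \<in> carrier_vec n" using w Wc by auto
      have Q0: "Q *\<^sub>v w = 0\<^sub>v n" using van w \<open>\<not> k > 0\<close> Q by auto
      have "w = (P * Q) *\<^sub>v w" using PQ wc by simp
      also have "\<dots> = P *\<^sub>v (Q *\<^sub>v w)" by (rule assoc_mult_mat_vec[OF P Q wc])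
      also have "\<dots> = 0\<^sub>v n" unfolding Q0 using P by auto
      finally show ?thesis .
    qed
    then show False using proper(1) W0 by blast
  qed
  moreover have "k < n" using full proper(2) kn by (metis le_neq_implies_less)
  moreover define m where "m = n - k"
  ultimately have n: "n = k + m" and km: "0 < k" "0 < m" by auto
  define R where "R g = Q * (\<rho> g * P)" for g
  note \<rho>c = representation_carrier[OF \<rho>]
  have Rc: "R g \<in> carrier_mat n n" if "g \<in> carrier G" for g
    using \<rho>c[OF that] P Q unfolding R_def by auto
  have R_mult: "R (g \<otimes> h) = R g * R h" if "g \<in> carrier G" "h \<in> carrier G" for g h
  proof -
    note c = \<rho>c[OF that(1)] \<rho>c[OF that(2)]
    have "R g * R h = Q * ((\<rho> g * P) * (Q * (\<rho> h * P)))"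
      unfolding R_def using c P Q by (simp add: assoc_mult_mat[of _ n n _ n _ n])
    also have "(\<rho> g * P) * (Q * (\<rho> h * P)) = \<rho> g * ((P * Q) * (\<rho> h * P))"
      using c P Q by (simp add: assoc_mult_mat[of _ n n _ n _ n])
    also have "(P * Q) * (\<rho> h * P) = \<rho> h * P"
      using PQ c P by simp
    also have "\<rho> g * (\<rho> h * P) = \<rho> (g \<otimes> h) * P"
      using representation_mult[OF \<rho> that] c P by (simp add: assoc_mult_mat[of _ n n _ n _ n])
    finally show ?thesis unfolding R_def by simp
  qed
  have R_one: "R \<one> = 1\<^sub>m n"
    unfolding R_def representation_one[OF \<rho>] using P QP by simp
  have R_zero: "R g $$ (k + i, j) = 0" if g: "g \<in> carrier G" and ij: "i < m" "j < k" for g i j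
  proof -
    note gc = \<rho>c[OF g]
    have "R g $$ (k + i, j) = col (R g) j $ (k + i)"
      using Rc[OF g] ij n by simp
    also have "col (R g) j = Q *\<^sub>v col (\<rho> g * P) j"
      unfolding R_def by (rule col_mult2[of _ n n _ n]) (use gc P Q ij n in auto)
    also have "col (\<rho> g * P) j = \<rho> g *\<^sub>v col P j"
      by (rule col_mult2[of _ n n _ n]) (use gc P ij n in auto)
    finally show ?thesis
      using van inv[OF g] colP ij n by simp
  qed
  have split: "(\<Sum>p<n. f p) = (\<Sum>p<k. f p) + (\<Sum>p<m. f (k + p))" for f :: "nat \<Rightarrow> complex"
    unfolding n by (induction m) (simp_all add: add.assoc)
  have R_entry: "R (g \<otimes> h) $$ (i, j) =
      (\<Sum>p<k. R g $$ (i, p) * R h $$ (p, j)) + (\<Sum>p<m. R g $$ (i, k + p) * R h $$ (k + p, j))"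
    if "g \<in> carrier G" "h \<in> carrier G" "i < n" "j < n" for g h i j
    using mat_mult_entry[OF Rc[OF that(1)] Rc[OF that(2)] that(3,4)] R_mult[OF that(1,2)] split by simp
  define \<sigma> where "\<sigma> g = Matrix.mat k k (\<lambda>(i, j). R g $$ (i, j))" for g
  define \<tau> where "\<tau> g = Matrix.mat m m (\<lambda>(i, j). R g $$ (k + i, k + j))" for g
  have "\<sigma> (g \<otimes> h) = \<sigma> g * \<sigma> h" if "g \<in> carrier G" "h \<in> carrier G" for g h
    by (rule eq_matI)
      (use that n in \<open>auto simp: \<sigma>_def R_entry R_zero scalar_prod_def lessThan_atLeast0\<close>)
  then have \<sigma>: "complex_representation G k \<sigma>"
    unfolding complex_representation_iff by (auto simp: \<sigma>_def R_one n)
  have "\<tau> (g \<otimes> h) = \<tau> g * \<tau> h" if "g \<in> carrier G" "h \<in> carrier G" for g h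
    by (rule eq_matI)
      (use that n in \<open>auto simp: \<tau>_def R_entry R_zero scalar_prod_def lessThan_atLeast0\<close>)
  then have \<tau>: "complex_representation G (n - k) \<tau>"
    unfolding complex_representation_iff by (auto simp: \<tau>_def R_one n)
  have tr: "mat_trace (\<rho> g) = mat_trace (\<sigma> g) + mat_trace (\<tau> g)" if g: "g \<in> carrier G" for g
  proof -
    have "mat_trace (R g) = mat_trace ((\<rho> g * P) * Q)"
      unfolding R_def by (rule mat_trace_mult_commute[of _ n n]) (use \<rho>c[OF g] P Q in auto)
    also have "(\<rho> g * P) * Q = \<rho> g"
      using \<rho>c[OF g] P Q PQ by (simp add: assoc_mult_mat[of _ n n _ n _ n])
    finally show ?thesis
      using mat_trace_eq_sum[OF Rc[OF g]] split by (simp add: mat_trace_def \<sigma>_def \<tau>_def)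
  qed
  show thesis by (rule that[of k \<sigma> \<tau>]) (use \<sigma> \<tau> tr km n in auto)
qed

end

section \<open>Schur's lemma\<close>

lemma eq_zero_mat_if_mult_vec_zero:
  fixes T :: "'a::field Matrix.mat"
  assumes T: "T \<in> carrier_mat n m" and "\<And>v. v \<in> carrier_vec m \<Longrightarrow> T *\<^sub>v v = 0\<^sub>v n"
  shows "T = 0\<^sub>m n m"
proof (rule eq_matI)
  fix i j assume ij: "i < dim_row (0\<^sub>m n m)" "j < dim_col (0\<^sub>m n m)"
  have "T $$ (i, j) = (T *\<^sub>v unit_vec m j) $ i" using T ij by simp
  also have "\<dots> = 0" using assms(2)[of "unit_vec m j"] ij by simp
  finally show "T $$ (i, j) = 0\<^sub>m n m $$ (i, j)" using ij by simp
qed (use T in auto)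

context group
begin

lemma irreducible_representationD:
  assumes "irreducible_representation G n \<rho>"
  shows "complex_representation G n \<rho>" "n > 0"
    and "VectorSpace.subspace class_ring W (module_vec TYPE(complex) n) \<Longrightarrow>
      (\<And>g w. g \<in> carrier G \<Longrightarrow> w \<in> W \<Longrightarrow> \<rho> g *\<^sub>v w \<in> W) \<Longrightarrow> W = {0\<^sub>v n} \<or> W = carrier_vec n"
  using assms unfolding irreducible_representation_def by blast+

text \<open>The kernel and the image of an intertwiner are invariant, so irreducibility leaves only zero and
  isomorphisms. The conclusion is a two-sided inverse because conjugating by it and taking traces
  identifies the characters.\<close>

lemma Schur_invertible:
  assumes \<sigma>: "irreducible_representation G n \<sigma>" and \<rho>: "irreducible_representation G m \<rho>"
    and T: "T \<in> carrier_mat n m" and comm: "\<And>g. g \<in> carrier G \<Longrightarrow> \<sigma> g * T = T * \<rho> g"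
    and nz: "T \<noteq> 0\<^sub>m n m"
  obtains S where "S \<in> carrier_mat m n" "T * S = 1\<^sub>m n" "S * T = 1\<^sub>m m"
proof -
  note \<sigma>c = representation_carrier[OF irreducible_representationD(1)[OF \<sigma>]]
  note \<rho>c = representation_carrier[OF irreducible_representationD(1)[OF \<rho>]]
  have comm_vec: "T *\<^sub>v (\<rho> g *\<^sub>v v) = \<sigma> g *\<^sub>v (T *\<^sub>v v)"
    if "g \<in> carrier G" "v \<in> carrier_vec m" for g v
    using assoc_mult_mat_vec[OF T \<rho>c[OF that(1)] that(2)]
      assoc_mult_mat_vec[OF \<sigma>c[OF that(1)] T that(2)] comm[OF that(1)] by simp
  define K where "K = {v \<in> carrier_vec m. T *\<^sub>v v = 0\<^sub>v n}"
  have "K = {0\<^sub>v m} \<or> K = carrier_vec m"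
  proof (rule irreducible_representationD(3)[OF \<rho>])
    show "VectorSpace.subspace class_ring K (module_vec TYPE(complex) m)"
      unfolding subspace_vec_iff K_def using T
      by (auto simp: mult_add_distrib_mat_vec[OF T] mult_mat_vec[OF T])
    show "\<rho> g *\<^sub>v w \<in> K" if "g \<in> carrier G" "w \<in> K" for g w
      using that comm_vec \<rho>c \<sigma>c unfolding K_def by fastforce
  qed
  then have K: "K = {0\<^sub>v m}"
    using eq_zero_mat_if_mult_vec_zero[OF T] nz unfolding K_def by blast
  define I where "I = (\<lambda>v. T *\<^sub>v v) ` carrier_vec m"
  have Iin: "T *\<^sub>v v \<in> I" if "v \<in> carrier_vec m" for v using that unfolding I_def by blast
  have "I = {0\<^sub>v n} \<or> I = carrier_vec n"
  proof (rule irreducible_representationD(3)[OF \<sigma>])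
    have "T *\<^sub>v 0\<^sub>v m \<in> I" by (rule Iin) simp
    moreover have "T *\<^sub>v 0\<^sub>v m = 0\<^sub>v n" using T by auto
    ultimately have "0\<^sub>v n \<in> I" by simp
    moreover have "T *\<^sub>v v + T *\<^sub>v w \<in> I" if "v \<in> carrier_vec m" "w \<in> carrier_vec m" for v w
      using Iin[of "v + w"] that mult_add_distrib_mat_vec[OF T] by simp
    moreover have "c \<cdot>\<^sub>v (T *\<^sub>v v) \<in> I" if "v \<in> carrier_vec m" for v c
      using Iin[of "c \<cdot>\<^sub>v v"] that mult_mat_vec[OF T] by simp
    ultimately show "VectorSpace.subspace class_ring I (module_vec TYPE(complex) n)"
      unfolding subspace_vec_iff using T by (auto simp: I_def)
    show "\<sigma> g *\<^sub>v w \<in> I" if g: "g \<in> carrier G" and w: "w \<in> I" for g w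
    proof -
      obtain v where v: "v \<in> carrier_vec m" "w = T *\<^sub>v v" using w unfolding I_def by blast
      have "\<rho> g *\<^sub>v v \<in> carrier_vec m" using \<rho>c[OF g] v(1) by simp
      then show ?thesis using Iin comm_vec[OF g v(1)] v(2) by metis
    qed
  qed
  then have "I = carrier_vec n"
    using eq_zero_mat_if_mult_vec_zero[OF T] nz Iin by blast
  then have "\<forall>j. \<exists>v. v \<in> carrier_vec m \<and> T *\<^sub>v v = unit_vec n j"
    unfolding I_def by (metis (no_types, lifting) imageE unit_vec_carrier)
  then obtain s where s: "\<And>j. s j \<in> carrier_vec m" "\<And>j. T *\<^sub>v s j = unit_vec n j"
    by metis
  \<comment> \<open>The columns of the right inverse are preimages of the unit vectors.\<close>
  define S where "S = Matrix.mat m n (\<lambda>(i, j). s j $ i)"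
  have S: "S \<in> carrier_mat m n" unfolding S_def by simp
  have colS: "col S j = s j" if "j < n" for j
    using that s(1)[of j] unfolding S_def by auto
  have TS: "T * S = 1\<^sub>m n"
  proof (rule eq_matI)
    fix i j assume ij: "i < dim_row (1\<^sub>m n)" "j < dim_col (1\<^sub>m n)"
    then have "(T * S) $$ (i, j) = (T *\<^sub>v s j) $ i"
      using T S colS by simp
    then show "(T * S) $$ (i, j) = 1\<^sub>m n $$ (i, j)" using s(2) ij by (simp add: unit_vec_def)
  qed (use T S in auto)
  \<comment> \<open>Each column of \<open>S * T - 1\<close> lies in the kernel of \<open>T\<close>, because \<open>T * (S * T) = T\<close>.\<close>
  have "S * T = 1\<^sub>m m"
  proof (rule mat_col_eqI)
    fix j assume j: "j < dim_col (1\<^sub>m m)"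
    then have j: "j < m" by simp
    define v where "v = col (S * T) j - unit_vec m j"
    have c: "col (S * T) j \<in> carrier_vec m" using S T j by (simp add: carrier_vecI)
    have "T *\<^sub>v col (S * T) j = col (T * (S * T)) j"
      using col_mult2[OF T _ j, of "S * T"] S T by simp
    also have "T * (S * T) = T" using assoc_mult_mat[OF T S T] TS T by simp
    finally have "T *\<^sub>v col (S * T) j = col T j" .
    moreover have "T *\<^sub>v unit_vec m j = col T j"
      using T j by (intro eq_vecI) auto
    ultimately have "T *\<^sub>v v = 0\<^sub>v n"
      unfolding v_def using mult_minus_distrib_mat_vec[OF T c unit_vec_carrier] T j by simp
    moreover have "v \<in> carrier_vec m" using c unfolding v_def by simp
    ultimately have "v = 0\<^sub>v m" using K unfolding K_def by blast
    then have diff: "col (S * T) j - unit_vec m j = 0\<^sub>v m" unfolding v_def .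
    have "col (S * T) j = unit_vec m j"
    proof (rule eq_vecI)
      fix i assume "i < dim_vec (unit_vec m j)"
      then have i: "i < m" by simp
      have "(col (S * T) j - unit_vec m j) $ i = 0" unfolding diff using i by simp
      then show "col (S * T) j $ i = unit_vec m j $ i" using i by simp
    qed (use carrier_vecD[OF c] in simp)
    then show "col (S * T) j = col (1\<^sub>m m) j" using j by simp
  qed (use S T in auto)
  then show thesis using that S TS by blast
qed

text \<open>Over the complex numbers \<open>T\<close> has an eigenvalue \<open>c\<close>. Then \<open>T - c\<close> also commutes with the
  representation and is not injective, so it cannot be invertible and must vanish.\<close>

lemma Schur_scalar:
  assumes \<rho>: "irreducible_representation G n \<rho>"
    and T: "T \<in> carrier_mat n n" and comm: "\<And>g. g \<in> carrier G \<Longrightarrow> \<rho> g * T = T * \<rho> g"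
  obtains c where "T = c \<cdot>\<^sub>m 1\<^sub>m n"
proof -
  obtain c where "eigenvalue T c"
    using spectrum_non_empty[OF T irreducible_representationD(2)[OF \<rho>]] unfolding spectrum_def by auto
  then obtain v where v: "v \<in> carrier_vec n" "v \<noteq> 0\<^sub>v n" "T *\<^sub>v v = c \<cdot>\<^sub>v v"
    using T unfolding eigenvalue_def eigenvector_def by auto
  let ?T = "T - c \<cdot>\<^sub>m 1\<^sub>m n"
  have T': "?T \<in> carrier_mat n n" using T by auto
  have "?T = 0\<^sub>m n n"
  proof (rule ccontr)
    assume nz: "?T \<noteq> 0\<^sub>m n n"
    have comm': "\<rho> g * ?T = ?T * \<rho> g" if g: "g \<in> carrier G" for g
    proof -
      note gc = representation_carrier[OF irreducible_representationD(1)[OF \<rho>] g]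
      have "\<rho> g * ?T = \<rho> g * T - \<rho> g * (c \<cdot>\<^sub>m 1\<^sub>m n)"
        by (rule mult_minus_distrib_mat[OF gc T]) simp
      also have "\<rho> g * (c \<cdot>\<^sub>m 1\<^sub>m n) = (c \<cdot>\<^sub>m 1\<^sub>m n) * \<rho> g"
        using gc by (simp add: mult_smult_distrib[OF gc one_carrier_mat] mult_smult_assoc_mat[OF one_carrier_mat gc])
      also have "\<rho> g * T - (c \<cdot>\<^sub>m 1\<^sub>m n) * \<rho> g = ?T * \<rho> g"
        unfolding comm[OF g] by (rule minus_mult_distrib_mat[symmetric, OF T _ gc]) simp
      finally show ?thesis .
    qed
    obtain S where S: "S \<in> carrier_mat n n" "S * ?T = 1\<^sub>m n"
      using Schur_invertible[OF \<rho> \<rho> T' comm' nz] by blast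
    have "?T *\<^sub>v v = T *\<^sub>v v - (c \<cdot>\<^sub>m 1\<^sub>m n) *\<^sub>v v"
      by (rule minus_mult_distrib_mat_vec[OF T _ v(1)]) simp
    also have "(c \<cdot>\<^sub>m 1\<^sub>m n) *\<^sub>v v = c \<cdot>\<^sub>v v"
    proof (rule eq_vecI)
      fix i assume "i < dim_vec (c \<cdot>\<^sub>v v)"
      then have i: "i < n" using v(1) by simp
      then have "Matrix.row (c \<cdot>\<^sub>m 1\<^sub>m n) i = c \<cdot>\<^sub>v unit_vec n i" by (intro eq_vecI) auto
      then show "((c \<cdot>\<^sub>m 1\<^sub>m n) *\<^sub>v v) $ i = (c \<cdot>\<^sub>v v) $ i" using i v(1) by simp
    qed (use v(1) in simp)
    finally have "?T *\<^sub>v v = 0\<^sub>v n" using v by auto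
    then have "S *\<^sub>v (?T *\<^sub>v v) = 0\<^sub>v n" using S by auto
    then have "v = 0\<^sub>v n" using assoc_mult_mat_vec[OF S(1) T' v(1)] S v by simp
    then show False using v by simp
  qed
  then have "T = c \<cdot>\<^sub>m 1\<^sub>m n"
    using T by (auto simp: mat_eq_iff)
  then show thesis using that by blast
qed

end

section \<open>Orthogonality of irreducible characters\<close>

context group
begin

lemma sum_translate_left:
  "h \<in> carrier G \<Longrightarrow> (\<Sum>g\<in>carrier G. f (h \<otimes> g)) = (\<Sum>g\<in>carrier G. f g)"
  by (rule sum.reindex_bij_witness[of _ "\<lambda>g. inv h \<otimes> g" "\<lambda>g. h \<otimes> g"])
    (auto simp: m_assoc[symmetric])

lemma character_apply: "g \<in> carrier G \<Longrightarrow> character G \<rho> g = mat_trace (\<rho> g)"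
  by (simp add: character_def)

lemma character_eq_sum:
  assumes "complex_representation G n \<rho>" "g \<in> carrier G"
  shows "character G \<rho> g = (\<Sum>i<n. \<rho> g $$ (i, i))"
  using assms by (simp add: character_apply mat_trace_eq_sum[OF representation_carrier])

lemma character_one: "complex_representation G n \<rho> \<Longrightarrow> character G \<rho> \<one> = of_nat n"
  by (simp add: character_apply representation_one mat_trace_one)

lemma irreducible_charactersE:
  assumes "\<phi> \<in> irreducible_characters G"
  obtains n \<rho> where "irreducible_representation G n \<rho>" "\<phi> = character G \<rho>"
  using assms unfolding irreducible_characters_def by blast

lemma irreducible_charactersI:
  "irreducible_representation G n \<rho> \<Longrightarrow> character G \<rho> \<in> irreducible_characters G"
  unfolding irreducible_characters_def by blast

lemma character_eq_if_equivalent: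
  assumes \<sigma>: "complex_representation G n \<sigma>" and \<rho>: "complex_representation G m \<rho>"
    and T: "T \<in> carrier_mat n m" and comm: "\<And>g. g \<in> carrier G \<Longrightarrow> \<sigma> g * T = T * \<rho> g"
    and S: "S \<in> carrier_mat m n" "T * S = 1\<^sub>m n" "S * T = 1\<^sub>m m"
  shows "character G \<sigma> = character G \<rho>"
proof
  fix g
  show "character G \<sigma> g = character G \<rho> g"
  proof (cases "g \<in> carrier G")
    case g: True
    note gc = representation_carrier[OF \<sigma> g] representation_carrier[OF \<rho> g]
    have "\<sigma> g = \<sigma> g * (T * S)" using S gc by simp
    also have "\<dots> = (T * \<rho> g) * S" using assoc_mult_mat[OF gc(1) T S(1)] comm[OF g] by simp
    finally have "mat_trace (\<sigma> g) = mat_trace (S * (T * \<rho> g))"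
      using mat_trace_mult_commute[OF mult_carrier_mat[OF T gc(2)] S(1)] by simp
    also have "S * (T * \<rho> g) = \<rho> g" using assoc_mult_mat[OF S(1) T gc(2)] S gc by simp
    finally show ?thesis using g by (simp add: character_apply)
  qed (simp add: character_def)
qed

text \<open>This is the sum \<open>\<Sum>g. \<sigma> g * E * \<rho> (inv g)\<close> of the matrix unit \<open>E\<close> at \<open>(k, l)\<close>, written out by
  entries. It makes Schur's lemma speak about products of matrix coefficients.\<close>

lemma averaged_matrix_unit_intertwines:
  assumes \<sigma>: "complex_representation G n \<sigma>" and \<rho>: "complex_representation G m \<rho>"
    and kl: "k < n" "l < m" and h: "h \<in> carrier G"
  defines "T \<equiv> Matrix.mat n m (\<lambda>(i, j). \<Sum>g\<in>carrier G. \<sigma> g $$ (i, k) * \<rho> (inv g) $$ (l, j))"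
  shows "\<sigma> h * T = T * \<rho> h"
proof -
  have T: "T \<in> carrier_mat n m" unfolding T_def by simp
  note hc = representation_carrier[OF \<sigma> h] representation_carrier[OF \<rho> h]
  show ?thesis
  proof (rule eq_matI)
    fix i j assume "i < dim_row (T * \<rho> h)" "j < dim_col (T * \<rho> h)"
    then have ij: "i < n" "j < m" using T hc by auto
    have "(\<sigma> h * T) $$ (i, j) =
        (\<Sum>p<n. \<sigma> h $$ (i, p) * (\<Sum>g\<in>carrier G. \<sigma> g $$ (p, k) * \<rho> (inv g) $$ (l, j)))"
      using mat_mult_entry[OF hc(1) T ij] ij by (simp add: T_def)
    also have "\<dots> = (\<Sum>g\<in>carrier G. (\<Sum>p<n. \<sigma> h $$ (i, p) * \<sigma> g $$ (p, k)) * \<rho> (inv g) $$ (l, j))"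
      by (simp add: sum_distrib_left sum_distrib_right mult.assoc sum.swap[of _ "carrier G" "{..<n}"])
    also have "\<dots> = (\<Sum>g\<in>carrier G. \<sigma> (h \<otimes> g) $$ (i, k) * \<rho> (inv g) $$ (l, j))"
      by (rule sum.cong) (simp_all add: representation_mult_entry[OF \<sigma> h _ ij(1) kl(1)])
    also have "\<dots> = (\<Sum>g\<in>carrier G. \<sigma> (h \<otimes> g) $$ (i, k) * \<rho> (inv (h \<otimes> g) \<otimes> h) $$ (l, j))"
      using h by (intro sum.cong) (simp_all add: inv_mult_group m_assoc)
    also have "\<dots> = (\<Sum>g\<in>carrier G. \<sigma> g $$ (i, k) * \<rho> (inv g \<otimes> h) $$ (l, j))"
      by (rule sum_translate_left[OF h])
    also have "\<dots> = (\<Sum>g\<in>carrier G. \<sigma> g $$ (i, k) * (\<Sum>p<m. \<rho> (inv g) $$ (l, p) * \<rho> h $$ (p, j)))"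
      by (rule sum.cong) (simp_all add: representation_mult_entry[OF \<rho> _ h kl(2) ij(2)])
    also have "\<dots> = (\<Sum>p<m. (\<Sum>g\<in>carrier G. \<sigma> g $$ (i, k) * \<rho> (inv g) $$ (l, p)) * \<rho> h $$ (p, j))"
      by (simp add: sum_distrib_left sum_distrib_right mult.assoc sum.swap[of _ "carrier G" "{..<m}"])
    also have "\<dots> = (T * \<rho> h) $$ (i, j)"
      using mat_mult_entry[OF T hc(2) ij] ij by (simp add: T_def)
    finally show "(\<sigma> h * T) $$ (i, j) = (T * \<rho> h) $$ (i, j)" .
  qed (use T hc in auto)
qed

text \<open>This agrees with the Hermitian product of characters up to the factor \<open>card (carrier G)\<close>, since the
  value of a character of a finite group at \<open>inv g\<close> is the conjugate of its value at \<open>g\<close>; with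
  \<open>inv g\<close> the orthogonality relations are purely algebraic.\<close>

definition character_pairing :: "('a \<Rightarrow> complex) \<Rightarrow> ('a \<Rightarrow> complex) \<Rightarrow> complex" where
  "character_pairing \<phi> \<psi> = (\<Sum>g\<in>carrier G. \<phi> g * \<psi> (inv g))"

lemma character_pairing_eq_sum:
  assumes \<sigma>: "complex_representation G n \<sigma>" and \<rho>: "complex_representation G m \<rho>"
  shows "character_pairing (character G \<sigma>) (character G \<rho>) =
    (\<Sum>k<n. \<Sum>l<m. \<Sum>g\<in>carrier G. \<sigma> g $$ (k, k) * \<rho> (inv g) $$ (l, l))"
proof -
  have "character_pairing (character G \<sigma>) (character G \<rho>) =
      (\<Sum>g\<in>carrier G. \<Sum>k<n. \<Sum>l<m. \<sigma> g $$ (k, k) * \<rho> (inv g) $$ (l, l))"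
    unfolding character_pairing_def
    by (intro sum.cong) (simp_all add: character_eq_sum[OF \<sigma>] character_eq_sum[OF \<rho>] sum_product)
  also have "\<dots> = (\<Sum>k<n. \<Sum>g\<in>carrier G. \<Sum>l<m. \<sigma> g $$ (k, k) * \<rho> (inv g) $$ (l, l))"
    by (rule sum.swap)
  also have "\<dots> = (\<Sum>k<n. \<Sum>l<m. \<Sum>g\<in>carrier G. \<sigma> g $$ (k, k) * \<rho> (inv g) $$ (l, l))"
    by (intro sum.cong sum.swap refl)
  finally show ?thesis .
qed

text \<open>If some averaged matrix unit were non-zero, it would be invertible by Schur's lemma and the two
  characters would agree. So all of them vanish, and the pairing is a sum of their entries.\<close>

lemma irreducible_characters_orthogonal:
  assumes "\<phi> \<in> irreducible_characters G" "\<psi> \<in> irreducible_characters G" "\<phi> \<noteq> \<psi>"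
  shows "character_pairing \<phi> \<psi> = 0"
proof -
  obtain n \<sigma> where \<sigma>: "irreducible_representation G n \<sigma>" and \<phi>: "\<phi> = character G \<sigma>"
    using assms(1) by (rule irreducible_charactersE)
  obtain m \<rho> where \<rho>: "irreducible_representation G m \<rho>" and \<psi>: "\<psi> = character G \<rho>"
    using assms(2) by (rule irreducible_charactersE)
  note \<sigma>' = irreducible_representationD(1)[OF \<sigma>] and \<rho>' = irreducible_representationD(1)[OF \<rho>]
  have "(\<Sum>g\<in>carrier G. \<sigma> g $$ (k, k) * \<rho> (inv g) $$ (l, l)) = 0" if kl: "k < n" "l < m" for k l
  proof -
    define T where "T = Matrix.mat n m (\<lambda>(i, j). \<Sum>g\<in>carrier G. \<sigma> g $$ (i, k) * \<rho> (inv g) $$ (l, j))"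
    have T: "T \<in> carrier_mat n m" unfolding T_def by simp
    have comm: "\<sigma> h * T = T * \<rho> h" if "h \<in> carrier G" for h
      unfolding T_def by (rule averaged_matrix_unit_intertwines[OF \<sigma>' \<rho>' kl that])
    have "T = 0\<^sub>m n m"
    proof (rule ccontr)
      assume "T \<noteq> 0\<^sub>m n m"
      then obtain S where "S \<in> carrier_mat m n" "T * S = 1\<^sub>m n" "S * T = 1\<^sub>m m"
        using Schur_invertible[OF \<sigma> \<rho> T comm] by blast
      then have "\<phi> = \<psi>"
        unfolding \<phi> \<psi> using character_eq_if_equivalent[OF \<sigma>' \<rho>' T comm] by blast
      then show False using assms(3) by simp
    qed
    then have "T $$ (k, l) = 0" using kl by simp
    then show ?thesis using kl by (simp add: T_def)
  qed
  then show ?thesis unfolding \<phi> \<psi> character_pairing_eq_sum[OF \<sigma>' \<rho>'] by simp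
qed

text \<open>Now each averaged matrix unit is a scalar, and its trace determines the scalar: it is \<open>N / n\<close> for
  the unit at \<open>(k, k)\<close> and \<open>0\<close> off the diagonal, where \<open>N\<close> is the group order.\<close>

lemma irreducible_character_norm:
  assumes "\<phi> \<in> irreducible_characters G"
  shows "character_pairing \<phi> \<phi> = of_nat (card (carrier G))"
proof -
  obtain n \<rho> where \<rho>: "irreducible_representation G n \<rho>" and \<phi>: "\<phi> = character G \<rho>"
    using assms by (rule irreducible_charactersE)
  note \<rho>' = irreducible_representationD(1)[OF \<rho>] and n = irreducible_representationD(2)[OF \<rho>]
  let ?N = "of_nat (card (carrier G)) :: complex"
  have entry: "(\<Sum>g\<in>carrier G. \<rho> g $$ (k, k) * \<rho> (inv g) $$ (l, l)) = (if k = l then ?N / of_nat n else 0)"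
    if kl: "k < n" "l < n" for k l
  proof -
    define T where "T = Matrix.mat n n (\<lambda>(i, j). \<Sum>g\<in>carrier G. \<rho> g $$ (i, k) * \<rho> (inv g) $$ (l, j))"
    have T: "T \<in> carrier_mat n n" unfolding T_def by simp
    have comm: "\<rho> h * T = T * \<rho> h" if "h \<in> carrier G" for h
      unfolding T_def by (rule averaged_matrix_unit_intertwines[OF \<rho>' \<rho>' kl that])
    obtain c where c: "T = c \<cdot>\<^sub>m 1\<^sub>m n" using Schur_scalar[OF \<rho> T comm] by blast
    have "of_nat n * c = mat_trace T" unfolding c mat_trace_def by simp
    also have "\<dots> = (\<Sum>i<n. \<Sum>g\<in>carrier G. \<rho> g $$ (i, k) * \<rho> (inv g) $$ (l, i))"
      unfolding mat_trace_eq_sum[OF T] by (simp add: T_def)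
    also have "\<dots> = (\<Sum>g\<in>carrier G. \<Sum>i<n. \<rho> (inv g) $$ (l, i) * \<rho> g $$ (i, k))"
      by (subst sum.swap) (simp add: mult.commute)
    also have "\<dots> = (\<Sum>g\<in>carrier G. \<rho> (inv g \<otimes> g) $$ (l, k))"
      by (intro sum.cong refl representation_mult_entry[OF \<rho>' _ _ kl(2,1), symmetric]) simp_all
    also have "\<dots> = (\<Sum>g\<in>carrier G. 1\<^sub>m n $$ (l, k))"
      by (rule sum.cong) (simp_all add: representation_one[OF \<rho>'])
    finally have "of_nat n * c = (if k = l then ?N else 0)" using kl by auto
    then have "c = (if k = l then ?N / of_nat n else 0)"
      using n by (auto simp: field_simps split: if_splits)
    moreover have "T $$ (k, l) = (if k = l then c else 0)" unfolding c using kl by simp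
    moreover have "T $$ (k, l) = (\<Sum>g\<in>carrier G. \<rho> g $$ (k, k) * \<rho> (inv g) $$ (l, l))"
      unfolding T_def using kl by simp
    ultimately show ?thesis by simp
  qed
  have "character_pairing \<phi> \<phi> = (\<Sum>k<n. \<Sum>l<n. if k = l then ?N / of_nat n else 0)"
    unfolding \<phi> character_pairing_eq_sum[OF \<rho>' \<rho>'] by (intro sum.cong refl entry) auto
  also have "\<dots> = ?N" using n by simp
  finally show ?thesis .
qed

end

section \<open>The number of irreducible characters\<close>

context group
begin

text \<open>Induction on the degree, splitting off an invariant subspace as long as there is one.\<close>

lemma trace_is_combination_of_irreducible_characters:
  "complex_representation G n \<rho> \<Longrightarrow>
    \<exists>S (m :: ('a \<Rightarrow> complex) \<Rightarrow> complex). finite S \<and> S \<subseteq> irreducible_characters G \<and>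
      (\<forall>g\<in>carrier G. mat_trace (\<rho> g) = (\<Sum>\<phi>\<in>S. m \<phi> * \<phi> g))"
proof (induction n arbitrary: \<rho> rule: less_induct)
  case (less n)
  note \<rho> = less.prems
  show ?case
  proof (cases "n = 0 \<or> irreducible_representation G n \<rho>")
    case True
    then show ?thesis
    proof
      assume n: "n = 0"
      have "mat_trace (\<rho> g) = 0" if "g \<in> carrier G" for g
        using mat_trace_eq_sum[OF representation_carrier[OF \<rho> that]] n by simp
      then show ?thesis by (intro exI[of _ "{}"]) simp
    next
      assume "irreducible_representation G n \<rho>"
      then have "character G \<rho> \<in> irreducible_characters G" by (rule irreducible_charactersI)
      then show ?thesis
        by (intro exI[of _ "{character G \<rho>}"] exI[of _ "\<lambda>_. 1"]) (simp add: character_apply)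
    qed
  next
    case False
    then obtain W where W: "VectorSpace.subspace class_ring W (module_vec TYPE(complex) n)"
      and "\<forall>g\<in>carrier G. \<forall>w\<in>W. \<rho> g *\<^sub>v w \<in> W"
      and proper: "W \<noteq> {0\<^sub>v n}" "W \<noteq> carrier_vec n"
      using \<rho> unfolding irreducible_representation_def neq0_conv[symmetric] by metis
    then have inv: "\<And>g w. g \<in> carrier G \<Longrightarrow> w \<in> W \<Longrightarrow> \<rho> g *\<^sub>v w \<in> W" by blast
    obtain k \<sigma> \<tau> where k: "0 < k" "k < n"
      and \<sigma>: "complex_representation G k \<sigma>" and \<tau>: "complex_representation G (n - k) \<tau>"
      and tr: "\<And>g. g \<in> carrier G \<Longrightarrow> mat_trace (\<rho> g) = mat_trace (\<sigma> g) + mat_trace (\<tau> g)"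
      using trace_splits_along_invariant_subspace[OF \<rho> W inv proper] by blast
    obtain S1 and m1 :: "('a \<Rightarrow> complex) \<Rightarrow> complex"
      where S1: "finite S1" "S1 \<subseteq> irreducible_characters G"
        "\<And>g. g \<in> carrier G \<Longrightarrow> mat_trace (\<sigma> g) = (\<Sum>\<phi>\<in>S1. m1 \<phi> * \<phi> g)"
      using less.IH[OF k(2) \<sigma>] by blast
    obtain S2 and m2 :: "('a \<Rightarrow> complex) \<Rightarrow> complex"
      where S2: "finite S2" "S2 \<subseteq> irreducible_characters G"
        "\<And>g. g \<in> carrier G \<Longrightarrow> mat_trace (\<tau> g) = (\<Sum>\<phi>\<in>S2. m2 \<phi> * \<phi> g)"
      using less.IH[OF _ \<tau>] k by auto
    define m where "m \<phi> = (if \<phi> \<in> S1 then m1 \<phi> else 0) + (if \<phi> \<in> S2 then m2 \<phi> else 0)" for \<phi>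
    have "mat_trace (\<rho> g) = (\<Sum>\<phi>\<in>S1 \<union> S2. m \<phi> * \<phi> g)" if g: "g \<in> carrier G" for g
    proof -
      have "(\<Sum>\<phi>\<in>S1 \<union> S2. m \<phi> * \<phi> g) =
          (\<Sum>\<phi>\<in>S1 \<union> S2. if \<phi> \<in> S1 then m1 \<phi> * \<phi> g else 0) +
          (\<Sum>\<phi>\<in>S1 \<union> S2. if \<phi> \<in> S2 then m2 \<phi> * \<phi> g else 0)"
        unfolding sum.distrib[symmetric] m_def by (rule sum.cong) (auto simp: distrib_right)
      also have "\<dots> = (\<Sum>\<phi>\<in>S1. m1 \<phi> * \<phi> g) + (\<Sum>\<phi>\<in>S2. m2 \<phi> * \<phi> g)"
        using S1(1) S2(1)
        by (simp add: sum.inter_restrict[symmetric] Int_absorb1)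
      finally show ?thesis using tr S1(3) S2(3) g by simp
    qed
    then show ?thesis using S1 S2 by (intro exI[of _ "S1 \<union> S2"] exI[of _ m]) auto
  qed
qed

text \<open>The matrices of the permutations \<open>x \<mapsto> g \<otimes> x\<close>, with respect to an enumeration \<open>e\<close> of the group;
  such a permutation has a fixed point only if \<open>g = \<one>\<close>.\<close>

lemma regular_representation:
  assumes fin: "finite (carrier G)"
  obtains \<rho> where "complex_representation G (card (carrier G)) \<rho>"
    "\<And>g. g \<in> carrier G \<Longrightarrow> mat_trace (\<rho> g) = (if g = \<one> then of_nat (card (carrier G)) else 0)"
proof -
  define N where "N = card (carrier G)"
  obtain e where e: "bij_betw e {..<N} (carrier G)"
    using ex_bij_betw_nat_finite[OF fin] unfolding N_def lessThan_atLeast0 by blast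
  have ec: "e i \<in> carrier G" if "i < N" for i using e that by (auto simp: bij_betw_def)
  have e_inj: "e i = e j \<longleftrightarrow> i = j" if "i < N" "j < N" for i j
    using e that by (auto simp: bij_betw_def inj_on_def)
  have e_surj: "\<exists>i<N. e i = g" if "g \<in> carrier G" for g
    using e that unfolding bij_betw_def by (metis imageE lessThan_iff)
  define \<rho> :: "'a \<Rightarrow> complex Matrix.mat"
    where "\<rho> g = Matrix.mat N N (\<lambda>(i, j). if g \<otimes> e j = e i then 1 else 0)" for g
  have c: "\<rho> g \<in> carrier_mat N N" for g unfolding \<rho>_def by simp
  have "\<rho> (g \<otimes> h) = \<rho> g * \<rho> h" if g: "g \<in> carrier G" and h: "h \<in> carrier G" for g h
  proof (rule eq_matI)
    fix i j assume "i < dim_row (\<rho> g * \<rho> h)" "j < dim_col (\<rho> g * \<rho> h)"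
    then have ij: "i < N" "j < N" by (simp_all add: \<rho>_def)
    obtain k where k: "k < N" "e k = h \<otimes> e j" using e_surj[of "h \<otimes> e j"] h ec ij by auto
    have "(\<rho> g * \<rho> h) $$ (i, j) = (\<Sum>p<N. \<rho> g $$ (i, p) * \<rho> h $$ (p, j))"
      by (rule mat_mult_entry[OF c c ij])
    also have "\<dots> = (\<Sum>p<N. if p = k then \<rho> g $$ (i, k) else 0)"
      by (rule sum.cong) (use ij k e_inj[OF k(1)] in \<open>auto simp: \<rho>_def simp flip: k(2)\<close>)
    also have "\<dots> = \<rho> g $$ (i, k)" using k(1) by simp
    also have "\<dots> = \<rho> (g \<otimes> h) $$ (i, j)"
      using ij k g h ec by (simp add: \<rho>_def m_assoc)
    finally show "\<rho> (g \<otimes> h) $$ (i, j) = (\<rho> g * \<rho> h) $$ (i, j)" by simp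
  qed (auto simp: \<rho>_def)
  moreover have "\<rho> \<one> = 1\<^sub>m N"
    by (rule eq_matI) (auto simp: \<rho>_def ec e_inj)
  ultimately have "complex_representation G N \<rho>"
    unfolding complex_representation_iff using c by blast
  moreover have "mat_trace (\<rho> g) = (if g = \<one> then of_nat N else 0)" if "g \<in> carrier G" for g
    unfolding mat_trace_eq_sum[OF c] using that ec by (auto simp: \<rho>_def)
  ultimately show thesis using that unfolding N_def by blast
qed

lemma irreducible_character_one_neq_0:
  assumes "\<phi> \<in> irreducible_characters G"
  shows "\<phi> \<one> \<noteq> 0"
proof -
  obtain n \<rho> where "irreducible_representation G n \<rho>" "\<phi> = character G \<rho>"
    using assms by (rule irreducible_charactersE)
  then show ?thesis using irreducible_representationD(1,2) character_one by fastforce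
qed

text \<open>The regular character is a combination of finitely many irreducible characters. Pairing it with
  any irreducible character \<open>\<psi>\<close> gives \<open>N * \<psi> \<one>\<close>, which is non-zero; by orthogonality \<open>\<psi>\<close> is one of
  those finitely many, with coefficient \<open>\<psi> \<one>\<close>. So there are no other irreducible characters.\<close>

lemma regular_character_decomposition:
  assumes fin: "finite (carrier G)"
  shows "finite (irreducible_characters G)"
    and "\<And>g. g \<in> carrier G \<Longrightarrow>
      (\<Sum>\<phi>\<in>irreducible_characters G. \<phi> \<one> * \<phi> g) = (if g = \<one> then of_nat (card (carrier G)) else 0)"
proof -
  let ?N = "of_nat (card (carrier G)) :: complex"
  have N: "?N \<noteq> 0" using fin by (auto simp: card_eq_0_iff)
  obtain \<rho> where \<rho>: "complex_representation G (card (carrier G)) \<rho>"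
    and tr: "\<And>g. g \<in> carrier G \<Longrightarrow> mat_trace (\<rho> g) = (if g = \<one> then ?N else 0)"
    using regular_representation[OF fin] by blast
  obtain S and m :: "('a \<Rightarrow> complex) \<Rightarrow> complex"
    where S: "finite S" "S \<subseteq> irreducible_characters G"
      and "\<And>g. g \<in> carrier G \<Longrightarrow> mat_trace (\<rho> g) = (\<Sum>\<phi>\<in>S. m \<phi> * \<phi> g)"
    using trace_is_combination_of_irreducible_characters[OF \<rho>] by blast
  then have reg: "(\<Sum>\<phi>\<in>S. m \<phi> * \<phi> g) = (if g = \<one> then ?N else 0)" if "g \<in> carrier G" for g
    using tr that by metis
  have mult: "\<psi> \<one> = (if \<psi> \<in> S then m \<psi> else 0)" if \<psi>: "\<psi> \<in> irreducible_characters G" for \<psi>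
  proof -
    have "?N * \<psi> \<one> = (\<Sum>g\<in>carrier G. if g = \<one> then ?N * \<psi> (inv g) else 0)"
      using fin by simp
    also have "\<dots> = (\<Sum>g\<in>carrier G. (\<Sum>\<phi>\<in>S. m \<phi> * \<phi> g) * \<psi> (inv g))"
      by (rule sum.cong) (auto simp: reg)
    also have "\<dots> = (\<Sum>\<phi>\<in>S. m \<phi> * character_pairing \<phi> \<psi>)"
      unfolding character_pairing_def
      by (simp add: sum_distrib_left sum_distrib_right mult.assoc sum.swap[of _ "carrier G" S])
    also have "\<dots> = (\<Sum>\<phi>\<in>S. if \<phi> = \<psi> then m \<psi> * ?N else 0)"
    proof (rule sum.cong)
      fix \<phi> assume "\<phi> \<in> S"
      then have "\<phi> \<in> irreducible_characters G" using S(2) by blast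
      then show "m \<phi> * character_pairing \<phi> \<psi> = (if \<phi> = \<psi> then m \<psi> * ?N else 0)"
        using irreducible_characters_orthogonal[OF _ \<psi>] irreducible_character_norm[OF \<psi>] by auto
    qed simp
    also have "\<dots> = (if \<psi> \<in> S then m \<psi> * ?N else 0)" using S(1) by simp
    finally show ?thesis using N by (auto split: if_splits)
  qed
  have S_eq: "S = irreducible_characters G"
    using S(2) mult irreducible_character_one_neq_0 by (metis subsetI subset_antisym)
  show "finite (irreducible_characters G)" using S(1) S_eq by simp
  show "(\<Sum>\<phi>\<in>irreducible_characters G. \<phi> \<one> * \<phi> g) = (if g = \<one> then ?N else 0)"
    if g: "g \<in> carrier G" for g
  proof -
    have "m \<phi> = \<phi> \<one>" if "\<phi> \<in> S" for \<phi>
      using mult[of \<phi>] S(2) that by (simp add: subset_iff)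
    then have "(\<Sum>\<phi>\<in>irreducible_characters G. \<phi> \<one> * \<phi> g) = (\<Sum>\<phi>\<in>S. m \<phi> * \<phi> g)"
      unfolding S_eq[symmetric] by simp
    then show ?thesis using reg[OF g] by simp
  qed
qed

text \<open>The sum \<open>Z\<close> of the matrices of \<open>x \<otimes> a \<otimes> inv x\<close> over all \<open>x\<close> commutes with the representation, so
  it is a scalar \<open>c\<close>; the trace of \<open>Z\<close> determines \<open>c\<close>, and the left-hand sum is the trace of
  \<open>Z * \<rho> h\<close>.\<close>

lemma irreducible_character_class_sum:
  assumes "\<phi> \<in> irreducible_characters G" and a: "a \<in> carrier G" and h: "h \<in> carrier G"
  shows "\<phi> \<one> * (\<Sum>x\<in>carrier G. \<phi> (x \<otimes> a \<otimes> inv x \<otimes> h)) =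
    of_nat (card (carrier G)) * (\<phi> a * \<phi> h)"
proof -
  obtain n \<rho> where \<rho>: "irreducible_representation G n \<rho>" and \<phi>: "\<phi> = character G \<rho>"
    using assms(1) by (rule irreducible_charactersE)
  note \<rho>' = irreducible_representationD(1)[OF \<rho>]
  note carr = representation_carrier[OF \<rho>']
  define Z where "Z = Matrix.mat n n (\<lambda>(i, j). \<Sum>x\<in>carrier G. \<rho> (x \<otimes> a \<otimes> inv x) $$ (i, j))"
  have Z: "Z \<in> carrier_mat n n" unfolding Z_def by simp
  have Z_left: "(\<rho> g * Z) $$ (i, j) = (\<Sum>x\<in>carrier G. \<rho> (g \<otimes> (x \<otimes> a \<otimes> inv x)) $$ (i, j))"
    if g: "g \<in> carrier G" and ij: "i < n" "j < n" for g i j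
    using mat_mult_entry[OF carr[OF g] Z ij] ij a g
    by (simp add: Z_def representation_mult_entry[OF \<rho>'] sum_distrib_left
        sum.swap[of _ "carrier G" "{..<n}"])
  have Z_right: "(Z * \<rho> g) $$ (i, j) = (\<Sum>x\<in>carrier G. \<rho> (x \<otimes> a \<otimes> inv x \<otimes> g) $$ (i, j))"
    if g: "g \<in> carrier G" and ij: "i < n" "j < n" for g i j
    using mat_mult_entry[OF Z carr[OF g] ij] ij a g
    by (simp add: Z_def representation_mult_entry[OF \<rho>', of "_ \<otimes> _ \<otimes> _" g] sum_distrib_right
        sum.swap[of _ "carrier G" "{..<n}"])
  have comm: "\<rho> g * Z = Z * \<rho> g" if g: "g \<in> carrier G" for g
  proof (rule eq_matI)
    fix i j assume "i < dim_row (Z * \<rho> g)" "j < dim_col (Z * \<rho> g)"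
    then have ij: "i < n" "j < n" using Z carr[OF g] by auto
    have "(\<rho> g * Z) $$ (i, j) =
        (\<Sum>x\<in>carrier G. \<rho> ((g \<otimes> x) \<otimes> a \<otimes> inv (g \<otimes> x) \<otimes> g) $$ (i, j))"
      unfolding Z_left[OF g ij] using a g
      by (intro sum.cong) (simp_all add: inv_mult_group m_assoc)
    also have "\<dots> = (Z * \<rho> g) $$ (i, j)"
      unfolding Z_right[OF g ij] by (rule sum_translate_left[OF g])
    finally show "(\<rho> g * Z) $$ (i, j) = (Z * \<rho> g) $$ (i, j)" .
  qed (use Z carr[OF g] in auto)
  obtain c where c: "Z = c \<cdot>\<^sub>m 1\<^sub>m n" using Schur_scalar[OF \<rho> Z comm] by blast
  have tr_conj: "mat_trace (\<rho> (x \<otimes> a \<otimes> inv x)) = \<phi> a" if x: "x \<in> carrier G" for x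
  proof -
    have "mat_trace (\<rho> (x \<otimes> a \<otimes> inv x)) = mat_trace (\<rho> x * \<rho> (a \<otimes> inv x))"
      using x a by (simp add: m_assoc flip: representation_mult[OF \<rho>'])
    also have "\<dots> = mat_trace (\<rho> (a \<otimes> inv x) * \<rho> x)"
      by (rule mat_trace_mult_commute[OF carr carr]) (use x a in simp_all)
    also have "\<rho> (a \<otimes> inv x) * \<rho> x = \<rho> a"
      using x a by (simp add: m_assoc flip: representation_mult[OF \<rho>'])
    finally show ?thesis using a by (simp add: \<phi> character_apply)
  qed
  have "of_nat n * c = mat_trace Z" unfolding c mat_trace_def by simp
  also have "\<dots> = (\<Sum>x\<in>carrier G. mat_trace (\<rho> (x \<otimes> a \<otimes> inv x)))"
    unfolding mat_trace_eq_sum[OF Z] using a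
    by (simp add: Z_def mat_trace_eq_sum[OF carr]
        sum.swap[of _ "carrier G" "{..<n}"])
  finally have nc: "of_nat n * c = of_nat (card (carrier G)) * \<phi> a" by (simp add: tr_conj)
  have "(\<Sum>x\<in>carrier G. \<phi> (x \<otimes> a \<otimes> inv x \<otimes> h)) = (\<Sum>i<n. (Z * \<rho> h) $$ (i, i))"
    using a h by (simp add: Z_right \<phi> character_eq_sum[OF \<rho>'] sum.swap[of _ "carrier G" "{..<n}"])
  also have "Z * \<rho> h = c \<cdot>\<^sub>m \<rho> h"
    unfolding c using mult_smult_assoc_mat[OF one_carrier_mat carr[OF h]] carr[OF h] by simp
  also have "(\<Sum>i<n. (c \<cdot>\<^sub>m \<rho> h) $$ (i, i)) = c * \<phi> h"
    using carr[OF h] h by (simp add: \<phi> character_eq_sum[OF \<rho>'] sum_distrib_left)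
  finally show ?thesis using nc character_one[OF \<rho>'] by (simp add: \<phi> mult.assoc[symmetric])
qed

text \<open>Summing \<open>irreducible_character_class_sum\<close> over all irreducible characters, with \<open>a = g\<close> and
  \<open>h = inv g\<close>, turns the left side into values of the regular character, which picks out the \<open>x\<close> that commute with \<open>g\<close>.\<close>

lemma column_orthogonality:
  assumes fin: "finite (carrier G)" and g: "g \<in> carrier G"
  shows "(\<Sum>\<phi>\<in>irreducible_characters G. \<phi> g * \<phi> (inv g)) =
    of_nat (card {x \<in> carrier G. x \<otimes> g \<otimes> inv x = g})"
proof -
  let ?N = "of_nat (card (carrier G)) :: complex"
  have N: "?N \<noteq> 0" using fin by (auto simp: card_eq_0_iff)
  have iff: "x \<otimes> g \<otimes> inv x \<otimes> inv g = \<one> \<longleftrightarrow> x \<otimes> g \<otimes> inv x = g" if "x \<in> carrier G" for x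
    using that g by (metis inv_closed inv_equality inv_inv m_closed r_inv)
  have "?N * (\<Sum>\<phi>\<in>irreducible_characters G. \<phi> g * \<phi> (inv g)) =
      (\<Sum>\<phi>\<in>irreducible_characters G. \<phi> \<one> * (\<Sum>x\<in>carrier G. \<phi> (x \<otimes> g \<otimes> inv x \<otimes> inv g)))"
    using g by (subst sum_distrib_left) (simp add: irreducible_character_class_sum)
  also have "\<dots> = (\<Sum>x\<in>carrier G. \<Sum>\<phi>\<in>irreducible_characters G. \<phi> \<one> * \<phi> (x \<otimes> g \<otimes> inv x \<otimes> inv g))"
    unfolding sum_distrib_left by (rule sum.swap)
  also have "\<dots> = (\<Sum>x\<in>carrier G. if x \<otimes> g \<otimes> inv x = g then ?N else 0)"
    using g iff by (intro sum.cong) (simp_all add: regular_character_decomposition(2)[OF fin])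
  also have "\<dots> = ?N * of_nat (card {x \<in> carrier G. x \<otimes> g \<otimes> inv x = g})"
    using fin by (simp add: sum.inter_filter[symmetric])
  finally show ?thesis using N by simp
qed

text \<open>The double sum of \<open>\<phi> g * \<phi> (inv g)\<close> is evaluated in two ways. Summing over \<open>g\<close> first gives the
  group order for each irreducible character; summing over \<open>\<phi>\<close> first gives the orders of the
  centralizers, whose total is the group order times the number of classes by Burnside's lemma for
  the conjugation action.\<close>

theorem card_irreducible_characters_eq_card_conjugacy_classes:
  assumes fin: "finite (carrier G)"
  shows "card (irreducible_characters G) = card (conjugacy_classes G)"
proof -
  let ?N = "card (carrier G)" and ?I = "irreducible_characters G"
  let ?conj = "\<lambda>g. \<lambda>h\<in>carrier G. g \<otimes> h \<otimes> inv g"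
  interpret conj: group_action G "carrier G" ?conj by (rule action_by_conjugation)
  have "card (conjugacy_classes G) * ?N = (\<Sum>x\<in>carrier G. card (invariants (carrier G) ?conj x))"
    using conj.burnside[OF fin fin] unfolding conjugacy_classes_def order_def by simp
  also have "\<dots> = (\<Sum>x\<in>carrier G. \<Sum>g\<in>carrier G. if x \<otimes> g \<otimes> inv x = g then 1 else 0)"
    using fin by (intro sum.cong)
      (auto simp: invariants_def sum.inter_filter[symmetric] intro!: arg_cong[of _ _ card])
  also have "\<dots> = (\<Sum>g\<in>carrier G. \<Sum>x\<in>carrier G. if x \<otimes> g \<otimes> inv x = g then 1 else 0)"
    by (rule sum.swap)
  also have "\<dots> = (\<Sum>g\<in>carrier G. card {x \<in> carrier G. x \<otimes> g \<otimes> inv x = g})"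
    using fin by (simp add: sum.inter_filter[symmetric])
  finally have "of_nat (card (conjugacy_classes G) * ?N) =
      (\<Sum>g\<in>carrier G. of_nat (card {x \<in> carrier G. x \<otimes> g \<otimes> inv x = g}) :: complex)"
    by simp
  also have "\<dots> = (\<Sum>g\<in>carrier G. \<Sum>\<phi>\<in>?I. \<phi> g * \<phi> (inv g))"
    by (rule sum.cong) (simp_all add: column_orthogonality[OF fin])
  also have "\<dots> = (\<Sum>\<phi>\<in>?I. character_pairing \<phi> \<phi>)"
    unfolding character_pairing_def by (rule sum.swap)
  also have "\<dots> = of_nat (card ?I * ?N)" by (simp add: irreducible_character_norm)
  finally have "card (conjugacy_classes G) * ?N = card ?I * ?N"
    using of_nat_eq_iff by blast
  moreover have "?N \<noteq> 0" using fin by (auto simp: card_eq_0_iff)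
  ultimately show ?thesis by simp
qed

end

section \<open>Characters of factor groups\<close>

context normal
begin

text \<open>The sum \<open>T\<close> of the matrices of the elements of \<open>H\<close> commutes with the representation, because \<open>H\<close>
  is normal, so it is a scalar; comparing traces shows that this scalar is the order of \<open>H\<close>. But
  \<open>\<rho> h * T = T\<close>, and cancelling the scalar leaves \<open>\<rho> h = 1\<close>.\<close>

lemma trivial_on_character_kernel:
  assumes \<rho>: "irreducible_representation G n \<rho>" and fin: "finite H"
    and ker: "H \<subseteq> character_kernel G (character G \<rho>)" and h: "h \<in> H"
  shows "\<rho> h = 1\<^sub>m n"
proof -
  note \<rho>' = irreducible_representationD(1)[OF \<rho>]
  note carr = representation_carrier[OF \<rho>']
  have HG: "a \<in> carrier G" if "a \<in> H" for a using that by (rule mem_carrier)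
  define T where "T = Matrix.mat n n (\<lambda>(i, j). \<Sum>a\<in>H. \<rho> a $$ (i, j))"
  have T: "T \<in> carrier_mat n n" unfolding T_def by simp
  have T_left: "(\<rho> g * T) $$ (i, j) = (\<Sum>a\<in>H. \<rho> (g \<otimes> a) $$ (i, j))"
    if g: "g \<in> carrier G" and ij: "i < n" "j < n" for g i j
    using mat_mult_entry[OF carr[OF g] T ij] ij g
    by (simp add: T_def HG representation_mult_entry[OF \<rho>'] sum_distrib_left sum.swap[of _ H "{..<n}"])
  have T_right: "(T * \<rho> g) $$ (i, j) = (\<Sum>a\<in>H. \<rho> (a \<otimes> g) $$ (i, j))"
    if g: "g \<in> carrier G" and ij: "i < n" "j < n" for g i j
    using mat_mult_entry[OF T carr[OF g] ij] ij g
    by (simp add: T_def HG representation_mult_entry[OF \<rho>'] sum_distrib_right sum.swap[of _ H "{..<n}"])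
  have comm: "\<rho> g * T = T * \<rho> g" if g: "g \<in> carrier G" for g
  proof (rule eq_matI)
    fix i j assume "i < dim_row (T * \<rho> g)" "j < dim_col (T * \<rho> g)"
    then have ij: "i < n" "j < n" using T carr[OF g] by auto
    have "(\<Sum>a\<in>H. \<rho> (g \<otimes> a) $$ (i, j)) = (\<Sum>a\<in>H. \<rho> (a \<otimes> g) $$ (i, j))"
    proof (rule sum.reindex_bij_witness[of _ "\<lambda>a. inv g \<otimes> a \<otimes> g" "\<lambda>a. g \<otimes> a \<otimes> inv g"])
      fix a assume a: "a \<in> H"
      have cancel: "inv g \<otimes> (g \<otimes> a) = a" "g \<otimes> (inv g \<otimes> a) = a"
        using g HG[OF a] by (simp_all flip: m_assoc)
      show "inv g \<otimes> (g \<otimes> a \<otimes> inv g) \<otimes> g = a" "g \<otimes> a \<otimes> inv g \<in> H"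
        "\<rho> (g \<otimes> a \<otimes> inv g \<otimes> g) $$ (i, j) = \<rho> (g \<otimes> a) $$ (i, j)"
        "g \<otimes> (inv g \<otimes> a \<otimes> g) \<otimes> inv g = a" "inv g \<otimes> a \<otimes> g \<in> H"
        using g HG[OF a] inv_op_closed1[OF g a] inv_op_closed2[OF g a]
        by (simp_all add: m_assoc cancel)
    qed
    then show "(\<rho> g * T) $$ (i, j) = (T * \<rho> g) $$ (i, j)"
      using T_left[OF g ij] T_right[OF g ij] by simp
  qed (use T carr[OF g] in auto)
  obtain c where c: "T = c \<cdot>\<^sub>m 1\<^sub>m n" using Schur_scalar[OF \<rho> T comm] by blast
  have N: "card H > 0" using fin h by (auto simp: card_gt_0_iff)
  have "of_nat n * c = mat_trace T" unfolding c mat_trace_def by simp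
  also have "\<dots> = (\<Sum>a\<in>H. character G \<rho> a)"
    unfolding mat_trace_eq_sum[OF T]
    by (simp add: T_def character_eq_sum[OF \<rho>'] HG sum.swap[of _ H "{..<n}"])
  also have "\<dots> = (\<Sum>a\<in>H. of_nat n)"
    using ker by (intro sum.cong) (auto simp: character_kernel_def character_one[OF \<rho>'])
  finally have c_eq: "c = of_nat (card H)" using irreducible_representationD(2)[OF \<rho>] by simp
  have "\<rho> h * T = T"
  proof (rule eq_matI)
    fix i j assume "i < dim_row T" "j < dim_col T"
    then have ij: "i < n" "j < n" using T by auto
    have "(\<Sum>a\<in>H. \<rho> (h \<otimes> a) $$ (i, j)) = (\<Sum>a\<in>H. \<rho> a $$ (i, j))"
      by (rule sum.reindex_bij_witness[of _ "\<lambda>a. inv h \<otimes> a" "\<lambda>a. h \<otimes> a"])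
        (auto simp: h HG m_assoc[symmetric])
    then show "(\<rho> h * T) $$ (i, j) = T $$ (i, j)"
      using T_left[OF HG[OF h] ij] ij by (simp add: T_def)
  qed (use T carr[OF HG[OF h]] in auto)
  then have "c \<cdot>\<^sub>m \<rho> h = c \<cdot>\<^sub>m 1\<^sub>m n"
    unfolding c using mult_smult_distrib[OF carr[OF HG[OF h]] one_carrier_mat] carr[OF HG[OF h]] by simp
  then have "c * \<rho> h $$ (i, j) = c * 1\<^sub>m n $$ (i, j)" if "i < n" "j < n" for i j
    using that carr[OF HG[OF h]] by (metis carrier_matD index_smult_mat(1) one_carrier_mat)
  then show ?thesis
    using carr[OF HG[OF h]] c_eq N by (intro eq_matI) auto
qed

lemma inflated_irreducible_iff:
  assumes "\<And>g. g \<in> carrier G \<Longrightarrow> \<rho> g = \<rho>' (H #> g)"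
  shows "irreducible_representation G n \<rho> \<longleftrightarrow> irreducible_representation (G Mod H) n \<rho>'"
proof -
  interpret Q: group "G Mod H" by (rule factorgroup_is_group)
  have one: "H #> \<one> = H" using subset by (simp add: coset_mult_one)
  have mult: "H #> (g \<otimes> h) = (H #> g) <#> (H #> h)" if "g \<in> carrier G" "h \<in> carrier G" for g h
    using rcos_sum that by simp
  have rep: "complex_representation G n \<rho> \<longleftrightarrow> complex_representation (G Mod H) n \<rho>'"
    unfolding complex_representation_iff Q.complex_representation_iff carrier_FactGroup
    using assms assms[of \<one>] by (simp add: one mult[symmetric])
  show ?thesis
    unfolding irreducible_representation_def rep carrier_FactGroup using assms by simp
qed

text \<open>Composing with the quotient map is injective on characters, and a representation comes from the
  factor group iff \<open>H\<close> acts trivially, which by \<open>trivial_on_character_kernel\<close> can be read off the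
  character.\<close>

lemma card_irreducible_characters_factor_group:
  assumes fin: "finite H"
  shows "card (irreducible_characters (G Mod H)) =
    card {\<psi> \<in> irreducible_characters G. H \<subseteq> character_kernel G \<psi>}"
proof -
  interpret Q: group "G Mod H" by (rule factorgroup_is_group)
  define infl :: "('a set \<Rightarrow> complex) \<Rightarrow> 'a \<Rightarrow> complex"
    where "infl \<phi> = (\<lambda>g\<in>carrier G. \<phi> (H #> g))" for \<phi>
  have infl_character: "infl (character (G Mod H) \<rho>') = character G \<rho>"
    if "\<And>g. g \<in> carrier G \<Longrightarrow> \<rho> g = \<rho>' (H #> g)" for \<rho> \<rho>'
    using that by (auto simp: infl_def character_def carrier_FactGroup)
  have "bij_betw infl (irreducible_characters (G Mod H))
      {\<psi> \<in> irreducible_characters G. H \<subseteq> character_kernel G \<psi>}"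
    unfolding bij_betw_def
  proof
    show "inj_on infl (irreducible_characters (G Mod H))"
    proof (rule inj_onI)
      fix \<phi> \<psi>
      assume "\<phi> \<in> irreducible_characters (G Mod H)" "\<psi> \<in> irreducible_characters (G Mod H)"
      then have ext: "\<phi> \<in> extensional (carrier (G Mod H))" "\<psi> \<in> extensional (carrier (G Mod H))"
        by (auto simp: irreducible_characters_def character_def)
      assume eq: "infl \<phi> = infl \<psi>"
      show "\<phi> = \<psi>"
      proof (rule extensionalityI[OF ext])
        fix X assume "X \<in> carrier (G Mod H)"
        then obtain g where "g \<in> carrier G" "X = H #> g" by (auto simp: carrier_FactGroup)
        then show "\<phi> X = \<psi> X" using fun_cong[OF eq, of g] by (simp add: infl_def)
      qed
    qed
    show "infl ` irreducible_characters (G Mod H) =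
        {\<psi> \<in> irreducible_characters G. H \<subseteq> character_kernel G \<psi>}"
    proof (intro equalityI subsetI)
      fix \<psi> assume "\<psi> \<in> infl ` irreducible_characters (G Mod H)"
      then obtain n \<rho>' where \<rho>': "irreducible_representation (G Mod H) n \<rho>'"
        and \<psi>: "\<psi> = infl (character (G Mod H) \<rho>')"
        by (auto elim: Q.irreducible_charactersE)
      have "irreducible_representation G n (\<lambda>g. \<rho>' (H #> g))"
        using inflated_irreducible_iff[of "\<lambda>g. \<rho>' (H #> g)" \<rho>' n] \<rho>' by simp
      then have "\<psi> \<in> irreducible_characters G"
        using irreducible_charactersI infl_character[of "\<lambda>g. \<rho>' (H #> g)" \<rho>'] \<psi> by simp
      moreover have "H \<subseteq> character_kernel G \<psi>"
        by (auto simp: character_kernel_def \<psi> infl_def rcos_const subset coset_mult_one)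
      ultimately show "\<psi> \<in> {\<psi> \<in> irreducible_characters G. H \<subseteq> character_kernel G \<psi>}" by simp
    next
      fix \<psi> assume "\<psi> \<in> {\<psi> \<in> irreducible_characters G. H \<subseteq> character_kernel G \<psi>}"
      then obtain n \<rho> where \<rho>: "irreducible_representation G n \<rho>" and \<psi>: "\<psi> = character G \<rho>"
        and ker: "H \<subseteq> character_kernel G (character G \<rho>)"
        by (auto elim: irreducible_charactersE)
      note \<rho>_rep = irreducible_representationD(1)[OF \<rho>]
      have const: "\<rho> x = \<rho> y" if x: "x \<in> carrier G" and y: "y \<in> carrier G" and eq: "H #> x = H #> y" for x y
      proof -
        have "x \<in> H #> y" using rcos_self[OF x subgroup_axioms] eq by simp
        then obtain h where h: "h \<in> H" "x = h \<otimes> y" unfolding r_coset_def by auto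
        then show ?thesis
          using trivial_on_character_kernel[OF \<rho> fin ker h(1)] y
            representation_mult[OF \<rho>_rep, of h y] representation_carrier[OF \<rho>_rep y] mem_carrier[OF h(1)]
          by simp
      qed
      define \<rho>' where "\<rho>' X = \<rho> (SOME x. x \<in> carrier G \<and> H #> x = X)" for X
      have \<rho>': "\<rho>' (H #> g) = \<rho> g" if g: "g \<in> carrier G" for g
      proof -
        have "(SOME x. x \<in> carrier G \<and> H #> x = H #> g) \<in> carrier G \<and>
            H #> (SOME x. x \<in> carrier G \<and> H #> x = H #> g) = H #> g"
          by (rule someI[of _ g]) (simp add: g)
        then show ?thesis unfolding \<rho>'_def using const[OF _ g] by blast
      qed
      have "irreducible_representation (G Mod H) n \<rho>'"
        using inflated_irreducible_iff[of \<rho> \<rho>' n] \<rho>' \<rho> by simp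
      then have "character (G Mod H) \<rho>' \<in> irreducible_characters (G Mod H)"
        by (rule Q.irreducible_charactersI)
      moreover have "infl (character (G Mod H) \<rho>') = \<psi>"
        unfolding \<psi> by (rule infl_character) (simp add: \<rho>')
      ultimately show "\<psi> \<in> infl ` irreducible_characters (G Mod H)" by blast
    qed
  qed
  then show ?thesis by (rule bij_betw_same_card)
qed

theorem card_conjugacy_classes_eq_NFC_plus_FC:
  assumes fin: "finite (carrier G)"
  shows "card (conjugacy_classes G) = NFC G H + FC G H"
proof -
  have "finite H" using fin subset by (rule rev_finite_subset)
  let ?I = "irreducible_characters G"
  have "card ?I = card {\<psi> \<in> ?I. H \<subseteq> character_kernel G \<psi>} + card {\<psi> \<in> ?I. \<not> H \<subseteq> character_kernel G \<psi>}"
    using regular_character_decomposition(1)[OF fin]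
    by (subst card_Un_disjoint[symmetric]) (auto intro!: arg_cong[of _ _ card])
  then show ?thesis
    using card_irreducible_characters_eq_card_conjugacy_classes[OF fin]
      card_irreducible_characters_factor_group[OF \<open>finite H\<close>]
    unfolding NFC_def FC_def by simp
qed

end

theorem theorem2:
  fixes G A :: "(real^7^7) set"
  assumes "subgroup G SO"
    and "finite G"
    and "irreducible_linear_group G"
    and "imprimitive_linear_group G"
    and "\<not> quasi_primitive_linear_group G"
    and "A \<lhd> SO\<lparr>carrier := G\<rparr>"
    and "elementary_abelian_group (SO\<lparr>carrier := A\<rparr>)"
    and "extension_type_8 (SO\<lparr>carrier := G\<rparr>) A \<or> extension_type_64 (SO\<lparr>carrier := G\<rparr>) A"
    and "odd (Coset.order (SO\<lparr>carrier := G\<rparr> Mod A)) \<longrightarrow> split_extension (SO\<lparr>carrier := G\<rparr>) A"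
  shows "card (conjugacy_classes (SO\<lparr>carrier := G\<rparr>))
         = NFC (SO\<lparr>carrier := G\<rparr>) A + FC (SO\<lparr>carrier := G\<rparr>) A"
  using normal.card_conjugacy_classes_eq_NFC_plus_FC[OF assms(6)] assms(2) by simp

end
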